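(* Let $(X,d)$ be a Ptolemy space. Then the metric space $(X,\log(1+d))$, i.e. $X$ equipped with the distance $(x,y)\mapsto \log(1+d(x,y))$, is a strongly hyperbolic space with parameter $2$.
   Context: A metric space $(X,d)$ is called a Ptolemy space if $d(x_1,x_2)d(x_3,x_4)\leq d(x_1,x_4)d(x_2,x_3)+d(x_1,x_3)d(x_2,x_4)$ for all $x_1,x_2,x_3,x_4\in X$. A metric space $(Y,\rho)$ is strongly hyperbolic with parameter $\epsilon>0$ if $\exp(-\epsilon(x|y)_o)\leq \exp(-\epsilon(x|z)_o)+\exp(-\epsilon(z|y)_o)$ for all $x,y,z,o\in Y$, where $(x|y)_o=\frac12(\rho(o,x)+\rho(o,y)-\rho(x,y))$ is the Gromov product; equivalently, $\exp(\frac{\epsilon}{2}(\rho(x,y)+\rho(z,t)))\leq \exp(\frac{\epsilon}{2}(\rho(x,z)+\rho(y,t)))+\exp(\frac{\epsilon}{2}(\rho(x,t)+\rho(z,y)))$ for all $x,y,z,t\in Y$. *)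

theory Defs
  imports "HOL-Analysis.Abstract_Metric_Spaces"
begin

locale Ptolemy_space = Metric_space +
  assumes Ptolemy: "\<lbrakk>x1 \<in> M; x2 \<in> M; x3 \<in> M; x4 \<in> M\<rbrakk> \<Longrightarrow>
    d x1 x2 * d x3 x4 \<le> d x1 x4 * d x2 x3 + d x1 x3 * d x2 x4"

definition Gromov_product :: "('a \<Rightarrow> 'a \<Rightarrow> real) \<Rightarrow> 'a \<Rightarrow> 'a \<Rightarrow> 'a \<Rightarrow> real"
  where "Gromov_product \<rho> b x y = (\<rho> b x + \<rho> b y - \<rho> x y) / 2"

locale strongly_hyperbolic_space = Metric_space +
  fixes \<epsilon> :: real
  assumes parameter_pos: "\<epsilon> > 0"
    and strongly_hyperbolic: "\<lbrakk>x \<in> M; y \<in> M; z \<in> M; b \<in> M\<rbrakk> \<Longrightarrow>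
      exp (- \<epsilon> * Gromov_product d b x y)
        \<le> exp (- \<epsilon> * Gromov_product d b x z) + exp (- \<epsilon> * Gromov_product d b z y)"

end

theory Submission
  imports Defs
begin

text \<open>
  For the logarithmic distance \<open>\<rho> = ln (1 + d)\<close> one has \<open>exp (\<rho> x y) = 1 + d x y\<close>, so with
  \<open>\<epsilon> = 2\<close> the factor \<open>1/2\<close> of the Gromov product disappears and
  strong hyperbolicity becomes, after clearing denominators, the Ptolemy inequality for the
  function \<open>1 + d\<close>. Multiplied out, that inequality splits by degree in \<open>d\<close>: the quadratic
  part is the Ptolemy inequality for \<open>d\<close>, the linear part is the fact that in a metric space
  the two diagonals of a quadrilateral are together no longer than its perimeter, and the constant
  part is \<open>1 \<le> 2\<close>.
\<close>

text \<open>Subadditivity of \<open>t \<mapsto> ln (1 + t)\<close> on the nonnegative reals, from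
  \<open>1 + d x z \<le> (1 + d x y) * (1 + d y z)\<close>, gives the triangle inequality.\<close>

lemma (in Metric_space) Metric_space_ln_1_plus:
  "Metric_space M (\<lambda>x y. ln (1 + d x y))"
proof
  fix x y
  show "0 \<le> ln (1 + d x y)"
    by simp
  show "ln (1 + d x y) = ln (1 + d y x)"
    by (simp add: commute)
next
  fix x y
  assume "x \<in> M" "y \<in> M"
  moreover have "ln (1 + d x y) = 0 \<longleftrightarrow> d x y = 0"
    using nonneg[of x y] by (simp add: ln_eq_zero_iff add_pos_nonneg)
  ultimately show "ln (1 + d x y) = 0 \<longleftrightarrow> x = y"
    by simp
next
  fix x y z
  assume "x \<in> M" "y \<in> M" "z \<in> M"
  have pos: "0 < 1 + d u v" for u v
    using nonneg[of u v] by linarith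
  have "1 + d x z \<le> 1 + (d x y + d y z)"
    using triangle \<open>x \<in> M\<close> \<open>y \<in> M\<close> \<open>z \<in> M\<close> by simp
  also have "\<dots> \<le> (1 + d x y) * (1 + d y z)"
    by (simp add: algebra_simps)
  finally have "ln (1 + d x z) \<le> ln ((1 + d x y) * (1 + d y z))"
    by (simp add: pos)
  also have "\<dots> = ln (1 + d x y) + ln (1 + d y z)"
    using pos[of x y] pos[of y z] by (simp add: ln_mult)
  finally show "ln (1 + d x z) \<le> ln (1 + d x y) + ln (1 + d y z)" .
qed

text \<open>Each diagonal is at most half the perimeter, since it is bounded by the length of either of
  the two paths along the sides that join its endpoints.\<close>

lemma (in Metric_space) diagonals_le_perimeter:
  assumes "x \<in> M" "y \<in> M" "z \<in> M" "b \<in> M"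
  shows "d x y + d z b \<le> d x z + d z y + d y b + d b x"
proof -
  have "d x y \<le> d x z + d z y" "d x y \<le> d x b + d b y"
       "d z b \<le> d z x + d x b" "d z b \<le> d z y + d y b"
    using assms by (auto intro: triangle)
  then show ?thesis
    using commute[of x b] commute[of b y] commute[of z x] by linarith
qed

lemma (in Ptolemy_space) Ptolemy_1_plus:
  assumes "x \<in> M" "y \<in> M" "z \<in> M" "b \<in> M"
  shows "(1 + d x y) * (1 + d b z) \<le> (1 + d x z) * (1 + d b y) + (1 + d z y) * (1 + d b x)"
proof -
  have "d x y * d b z \<le> d x z * d b y + d z y * d b x"
    using Ptolemy[of x y b z] assms commute[of y z] commute[of x b] commute[of y b]
    by (simp add: mult.commute)
  moreover have "d x y + d b z \<le> d x z + d z y + d b y + d b x"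
    using diagonals_le_perimeter[OF assms] commute[of z b] commute[of y b] by simp
  ultimately show ?thesis
    by (simp add: algebra_simps)
qed

lemma (in Metric_space) exp_Gromov_product_ln_1_plus:
  "exp (- 2 * Gromov_product (\<lambda>x y. ln (1 + d x y)) b x y)
     = (1 + d x y) / ((1 + d b x) * (1 + d b y))"
proof -
  have pos: "0 < 1 + d u v" for u v
    using nonneg[of u v] by linarith
  have "- 2 * Gromov_product (\<lambda>x y. ln (1 + d x y)) b x y
      = ln (1 + d x y) - (ln (1 + d b x) + ln (1 + d b y))"
    by (simp add: Gromov_product_def)
  then show ?thesis
    by (simp only: exp_diff exp_add exp_ln[OF pos])
qed

theorem theorem2:
  fixes X :: "'a set" and d :: "'a \<Rightarrow> 'a \<Rightarrow> real"
  assumes "Ptolemy_space X d"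
  shows "strongly_hyperbolic_space X (\<lambda>x y. ln (1 + d x y)) 2"
proof -
  interpret Ptolemy_space X d by fact
  interpret log: Metric_space X "\<lambda>x y. ln (1 + d x y)"
    by (rule Metric_space_ln_1_plus)
  show ?thesis
  proof
    show "(0::real) < 2" by simp
  next
    fix x y z b
    assume "x \<in> X" "y \<in> X" "z \<in> X" "b \<in> X"
    define p q r where "p = 1 + d b x" and "q = 1 + d b y" and "r = 1 + d b z"
    have pos: "0 < p" "0 < q" "0 < r"
      unfolding p_def q_def r_def by (simp_all add: add_pos_nonneg)
    \<comment> \<open>\<open>p * q * r\<close> is the common denominator of the three exponentials.\<close>
    have "(1 + d x y) * r \<le> (1 + d x z) * q + (1 + d z y) * p"
      unfolding p_def q_def r_def by (rule Ptolemy_1_plus) fact+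
    then have "(1 + d x y) * r / (p * q * r) \<le> ((1 + d x z) * q + (1 + d z y) * p) / (p * q * r)"
      using pos by (intro divide_right_mono) simp_all
    then have "(1 + d x y) / (p * q) \<le> (1 + d x z) / (p * r) + (1 + d z y) / (r * q)"
      using pos by (simp add: add_divide_distrib mult.commute mult.left_commute)
    then show "exp (- 2 * Gromov_product (\<lambda>x y. ln (1 + d x y)) b x y)
        \<le> exp (- 2 * Gromov_product (\<lambda>x y. ln (1 + d x y)) b x z)
          + exp (- 2 * Gromov_product (\<lambda>x y. ln (1 + d x y)) b z y)"
      by (simp only: exp_Gromov_product_ln_1_plus p_def q_def r_def)
  qed
qed

end
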